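(* There exists an absolute constant $C>0$ such that for all integers $r,s$ with $2\le r\le s$, $$\frac18 r^2 s\le \tilde r(P_r,P_s)\le C r^2 s(\log s)^3.$$
   Context: An ordered graph on $n$ vertices is a finite simple graph whose vertices are labeled $1,2,\ldots,n$ (equivalently, a finite simple graph with a linear order on its vertices). The ordered path $P_n$ is the monotone increasing path with $n$ edges and $n+1$ vertices; a copy of $P_n$ in an ordered graph $H$ is a sequence of vertices $v_0<v_1<\cdots<v_n$ such that $v_{i-1}v_i$ is an edge of $H$ for every $1\le i\le n$. The ordered size Ramsey number $\tilde r(P_r,P_s)$ is the minimum number $m$ for which there exists an ordered graph $H$ with $m$ edges such that every coloring of the edges of $H$ with the two colors red and blue contains a copy of $P_r$ with all edges red or a copy of $P_s$ with all edges blue. $\log$ is the natural logarithm. *)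

theory Defs
  imports Complex_Main
begin

text \<open>An ordered graph on \<open>n\<close> vertices is given by \<open>n\<close> and its edge set; the vertex set is
  \<open>{1..n}\<close> with the usual order, and an edge is a two-element set of vertices.\<close>

definition ordered_graph :: "nat \<Rightarrow> nat set set \<Rightarrow> bool" where
  "ordered_graph n E \<longleftrightarrow> E \<subseteq> {e. e \<subseteq> {1..n} \<and> card e = 2}"

text \<open>The monotone path \<open>P\<^sub>k\<close> has \<open>k\<close> edges; a copy of it consists of the vertices
  \<open>v 0 < v 1 < \<dots> < v k\<close>. Values of \<open>v\<close> beyond \<open>k\<close> are irrelevant.\<close>

definition path_copy :: "nat \<Rightarrow> nat \<Rightarrow> nat set set \<Rightarrow> (nat \<Rightarrow> nat) \<Rightarrow> bool" where
  "path_copy k n E v \<longleftrightarrow>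
     (\<forall>i\<le>k. v i \<in> {1..n}) \<and>
     (\<forall>i<k. v i < v (Suc i) \<and> {v i, v (Suc i)} \<in> E)"

definition contains_path :: "nat \<Rightarrow> nat \<Rightarrow> nat set set \<Rightarrow> bool" where
  "contains_path k n E \<longleftrightarrow> (\<exists>v. path_copy k n E v)"

datatype colour = Red | Blue

text \<open>Colourings are total functions, but only their values on \<open>E\<close> matter.\<close>

definition ramsey_for_paths :: "nat \<Rightarrow> nat \<Rightarrow> nat \<Rightarrow> nat set set \<Rightarrow> bool" where
  "ramsey_for_paths r s n E \<longleftrightarrow>
     (\<forall>c :: nat set \<Rightarrow> colour.
        contains_path r n {e \<in> E. c e = Red} \<or> contains_path s n {e \<in> E. c e = Blue})"

text \<open>The infimum on \<^typ>\<open>nat\<close> is the minimum of a nonempty set, and \<open>Inf {} = 0\<close>. The set below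
  is nonempty by Ramsey's theorem; in any case a positive lower bound on
  \<open>ordered_size_ramsey r s\<close> cannot hold because of the convention for the empty set.\<close>

definition ordered_size_ramsey :: "nat \<Rightarrow> nat \<Rightarrow> nat" where
  "ordered_size_ramsey r s =
     Inf {m. \<exists>n E. ordered_graph n E \<and> card E = m \<and> ramsey_for_paths r s n E}"

end

theory Submission
  imports Defs "HOL-Analysis.Convex" "HOL-Analysis.Harmonic_Numbers"
begin

text \<open>Assigning to each vertex the lengths \<open>(a, b)\<close> of the longest red and blue paths ending there, a
  graph fails to be Ramsey iff its vertices can be mapped into the \<open>r \<times> s\<close> grid such that no
  edge \<open>u < v\<close> has both \<open>a v \<le> a u\<close> and \<open>b v \<le> b u\<close>.

  Lower bound: cut the vertices into intervals, one for each antidiagonal of the grid. An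
  interval may be mapped into an antidiagonal of size \<open>d\<close> by any proper \<open>d\<close>-colouring, and
  a graph that is not \<open>d\<close>-colourable has at least \<open>(d + 1) choose 2\<close> edges. So a Ramsey graph has
  at least as many edges as the sum of these numbers.

  Upper bound: among \<open>4 r s\<close> vertices some \<open>U\<close> of size \<open>4 s\<close> lies on a single value of \<open>a\<close>, so it
  suffices that every labelling \<open>b\<close> of every such \<open>U\<close> by \<open>s\<close> labels has an inversion that is an edge. Weighting
  the pair \<open>u < v\<close> by \<open>1 / (v - u)\<close>, the total weight is \<open>O(r s log s)\<close>, while the inversions of each
  labelling weigh at least \<open>s / (8 r)\<close>. A greedy hitting set of the \<open>exp (O(s log s))\<close> inversion
  sets therefore has \<open>O(r\<^sup>2 s (log s)\<^sup>2)\<close> edges.\<close>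

section \<open>Colouring graphs with few edges\<close>

text \<open>If every vertex had \<open>card D\<close> neighbours in \<open>V\<close>, then
  \<open>card V\<close> would exceed \<open>card D\<close>, and counting incidences would give at
  least \<open>(card D + 1) choose 2\<close> edges. So some vertex has lower degree; the rest is
  coloured by induction and leaves it a free colour.\<close>

lemma colouring_of_few_edges:
  assumes "finite V" "finite E" "\<And>e. e \<in> E \<Longrightarrow> card e = 2" "finite D"
    and "card {e \<in> E. e \<subseteq> V} < (card D + 1) choose 2"
  shows "\<exists>f. (\<forall>v\<in>V. f v \<in> D) \<and> (\<forall>u\<in>V. \<forall>v\<in>V. u \<noteq> v \<longrightarrow> {u, v} \<in> E \<longrightarrow> f u \<noteq> f v)"
  using assms(1,5)
proof (induction "card V" arbitrary: V)
  case 0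
  then show ?case by simp
next
  case (Suc k)
  let ?F = "{e \<in> E. e \<subseteq> V}"
  let ?N = "\<lambda>v. {w \<in> V. w \<noteq> v \<and> {v, w} \<in> E}"
  have fin: "finite ?F" using assms(2) by simp
  have N_le: "card (?N v) \<le> card {e \<in> ?F. v \<in> e}" if "v \<in> V" for v
  proof (rule card_inj_on_le[where f = "\<lambda>w. {v, w}"])
    show "inj_on (\<lambda>w. {v, w}) (?N v)" by (auto simp: inj_on_def doubleton_eq_iff)
    show "(\<lambda>w. {v, w}) ` ?N v \<subseteq> {e \<in> ?F. v \<in> e}" using that by auto
    show "finite {e \<in> ?F. v \<in> e}" by (rule finite_subset[OF _ fin]) blast
  qed
  have "\<exists>v\<in>V. card (?N v) < card D"
  proof (rule ccontr)
    assume "\<not> ?thesis"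
    then have ge: "\<And>v. v \<in> V \<Longrightarrow> card D \<le> card (?N v)" by (meson not_le)
    obtain v where v: "v \<in> V" using Suc(2) by fastforce
    have "?N v \<subseteq> V - {v}" by auto
    then have "card (?N v) \<le> card (V - {v})" using Suc.prems(1) by (intro card_mono) auto
    then have "card D + 1 \<le> card V" using ge[OF v] v Suc(2) Suc.prems(1) by simp
    then have "(card D + 1) * card D \<le> card V * card D" by (rule mult_le_mono1)
    also have "\<dots> = (\<Sum>v\<in>V. card D)" by simp
    also have "\<dots> \<le> (\<Sum>v\<in>V. card {e \<in> ?F. v \<in> e})"
      using ge N_le by (intro sum_mono) (meson le_trans)
    also have "\<dots> = 2 * card ?F"
    proof (rule sum_multicount[OF Suc.prems(1) fin], rule ballI)
      fix e assume e: "e \<in> ?F"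
      then have "{i \<in> V. i \<in> e} = e" by auto
      then show "card {i \<in> V. i \<in> e} = 2" using assms(3) e by simp
    qed
    finally show False using Suc.prems(2) by (simp add: choose_two)
  qed
  then obtain v where v: "v \<in> V" "card (?N v) < card D" by blast
  have "card {e \<in> E. e \<subseteq> V - {v}} \<le> card ?F" using fin by (intro card_mono) auto
  then have "card {e \<in> E. e \<subseteq> V - {v}} < (card D + 1) choose 2"
    using Suc.prems(2) by linarith
  moreover have "k = card (V - {v})" "finite (V - {v})"
    using Suc.hyps(2) Suc.prems(1) v(1) by simp_all
  ultimately have "\<exists>f. (\<forall>x\<in>V - {v}. f x \<in> D)
      \<and> (\<forall>u\<in>V - {v}. \<forall>w\<in>V - {v}. u \<noteq> w \<longrightarrow> {u, w} \<in> E \<longrightarrow> f u \<noteq> f w)"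
    using Suc.hyps(1) by simp
  then obtain f where f: "\<forall>x\<in>V - {v}. f x \<in> D"
    "\<forall>u\<in>V - {v}. \<forall>w\<in>V - {v}. u \<noteq> w \<longrightarrow> {u, w} \<in> E \<longrightarrow> f u \<noteq> f w"
    by (elim exE conjE) (rule that)
  have finN: "finite (?N v)" using Suc.prems(1) by simp
  then have "card (f ` ?N v) < card D" using v(2) card_image_le[of "?N v" f] by linarith
  then have "\<not> D \<subseteq> f ` ?N v" using finN card_mono[of "f ` ?N v" D] by (meson finite_imageI not_le)
  then obtain d where d: "d \<in> D" "d \<notin> f ` ?N v" by blast
  show ?case
  proof (intro exI[of _ "f(v := d)"] conjI ballI impI)
    fix x assume "x \<in> V" then show "(f(v := d)) x \<in> D" using f(1) d(1) by simp
  next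
    fix u w assume uw: "u \<in> V" "w \<in> V" "u \<noteq> w" "{u, w} \<in> E"
    have new: "f x \<noteq> d" if "x \<in> V" "x \<noteq> v" "{v, x} \<in> E" for x using d(2) that by blast
    consider "u = v" "w \<noteq> v" | "w = v" "u \<noteq> v" | "u \<noteq> v" "w \<noteq> v" using uw(3) by blast
    then show "(f(v := d)) u \<noteq> (f(v := d)) w"
    proof cases
      case 1
      then show ?thesis using new[of w] uw by simp
    next
      case 2
      then show ?thesis using new[of u] uw by (simp add: insert_commute)
    next
      case 3
      then show ?thesis using f(2) uw by simp
    qed
  qed
qed

text \<open>Final segments are peeled off from the right, each the longest that can be properly
  coloured from \<open>D k\<close>. One more vertex makes it uncolourable, which costs
  \<open>(card (D k) + 1) choose 2\<close> edges. There are too few edges to pay for all levels, so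
  the vertices run out first.\<close>

lemma level_colouring:
  fixes D :: "nat \<Rightarrow> 'a set"
  assumes "finite E" "\<And>e. e \<in> E \<Longrightarrow> card e = 2" "\<And>c. finite (D c)"
    and "card {e \<in> E. e \<subseteq> {1..n::nat}} < (\<Sum>c<k. (card (D c) + 1) choose 2)"
  shows "\<exists>h f. (\<forall>v\<in>{1..n}. h v < k \<and> f v \<in> D (h v)) \<and>
     (\<forall>u\<in>{1..n}. \<forall>v\<in>{1..n}. u < v \<longrightarrow> h u \<le> h v \<and> ({u, v} \<in> E \<longrightarrow> h u = h v \<longrightarrow> f u \<noteq> f v))"
  using assms(4)
proof (induction k arbitrary: n)
  case 0
  then show ?case by simp
next
  case (Suc k)
  define Q where "Q y \<longleftrightarrow> (\<exists>f. (\<forall>v\<in>{y..n}. f v \<in> D k) \<and>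
    (\<forall>u\<in>{y..n}. \<forall>v\<in>{y..n}. u \<noteq> v \<longrightarrow> {u, v} \<in> E \<longrightarrow> f u \<noteq> f v))" for y
  define y where "y = (LEAST y. Q y)"
  have "Q (Suc n)" unfolding Q_def by simp
  then have "Q y" unfolding y_def by (rule LeastI)
  then obtain g where g: "\<And>v. v \<in> {y..n} \<Longrightarrow> g v \<in> D k"
    "\<And>u v. u \<in> {y..n} \<Longrightarrow> v \<in> {y..n} \<Longrightarrow> u \<noteq> v \<Longrightarrow> {u, v} \<in> E \<Longrightarrow> g u \<noteq> g v"
    unfolding Q_def by blast
  show ?case
  proof (cases "y \<le> 1")
    case True
    then show ?thesis
      by (intro exI[of _ "\<lambda>_. k"] exI[of _ g]) (use g in auto)
  next
    case False
    have y_le: "y \<le> Suc n" unfolding y_def using \<open>Q (Suc n)\<close> by (rule Least_le)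
    have "\<not> Q (y - 1)" unfolding y_def using False not_less_Least[of "y - 1" Q] y_def by simp
    then have many: "card {e \<in> E. e \<subseteq> {y - 1..n}} \<ge> (card (D k) + 1) choose 2"
      using colouring_of_few_edges[OF _ assms(1,2,3), of "{y - 1..n}" k] unfolding Q_def
      by (metis (no_types, lifting) finite_atLeastAtMost not_le)
    \<comment> \<open>The two vertex ranges share only \<open>y - 1\<close>, so no edge is charged
      twice.\<close>
    let ?L = "{e \<in> E. e \<subseteq> {1..y - 1}}" and ?R = "{e \<in> E. e \<subseteq> {y - 1..n}}"
    have "e \<notin> ?R" if "e \<in> ?L" for e
    proof
      assume "e \<in> ?R"
      then have "e \<subseteq> {1..y - 1} \<inter> {y - 1..n}" using that by blast
      also have "\<dots> \<subseteq> {y - 1}" by auto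
      finally have "card e \<le> card {y - 1}" by (intro card_mono) auto
      then show False using assms(2)[of e] that by simp
    qed
    then have "card ?L + card ?R = card (?L \<union> ?R)"
      using assms(1) by (intro card_Un_disjoint[symmetric]) auto
    also have "\<dots> \<le> card {e \<in> E. e \<subseteq> {1..n}}"
    proof (intro card_mono Un_least)
      show "finite {e \<in> E. e \<subseteq> {1..n}}" using assms(1) by simp
      have "{1..y - 1} \<subseteq> {1..n}" "{y - 1..n} \<subseteq> {1..n}" using y_le False by auto
      then show "?L \<subseteq> {e \<in> E. e \<subseteq> {1..n}}" "?R \<subseteq> {e \<in> E. e \<subseteq> {1..n}}" by blast+
    qed
    finally have "card ?L < (\<Sum>c<k. (card (D c) + 1) choose 2)"
      using many Suc.prems by simp
    note IH = Suc.IH[OF this]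
    have "{1..y - 1} = {1..<y}" using False by auto
    from IH[unfolded this] obtain h f where hf:
      "\<And>v. v \<in> {1..<y} \<Longrightarrow> h v < k \<and> f v \<in> D (h v)"
      "\<And>u v. u \<in> {1..<y} \<Longrightarrow> v \<in> {1..<y} \<Longrightarrow> u < v \<Longrightarrow>
         h u \<le> h v \<and> ({u, v} \<in> E \<longrightarrow> h u = h v \<longrightarrow> f u \<noteq> f v)" by blast
    let ?h = "\<lambda>v. if v < y then h v else k" and ?f = "\<lambda>v. if v < y then f v else g v"
    show ?thesis
    proof (intro exI[of _ ?h] exI[of _ ?f] conjI ballI impI)
      fix v assume "v \<in> {1..n}"
      then show "?h v < Suc k" "?f v \<in> D (?h v)" using hf(1)[of v] g(1)[of v] by auto
    next
      fix u v assume uv: "u \<in> {1..n}" "v \<in> {1..n}" "u < v"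
      show "?h u \<le> ?h v" using hf(2)[of u v] hf(1)[of u] uv by auto
      assume "{u, v} \<in> E" "?h u = ?h v"
      then show "?f u \<noteq> ?f v"
        using hf(2)[of u v] hf(1)[of u] g(2)[of u v] uv by (auto split: if_splits)
    qed
  qed
qed

section \<open>Increasing labellings and monotone paths\<close>

text \<open>Each edge of a path raises the label by at least one, so the last vertex would have
  label at least \<open>k\<close>.\<close>

lemma no_path_of_increasing:
  fixes a :: "nat \<Rightarrow> nat"
  assumes "\<And>v. v \<in> {1..n} \<Longrightarrow> a v < k"
    and "\<And>u v. u \<in> {1..n} \<Longrightarrow> v \<in> {1..n} \<Longrightarrow> u < v \<Longrightarrow> {u, v} \<in> E \<Longrightarrow> a u < a v"
  shows "\<not> contains_path k n E"
proof
  assume "contains_path k n E"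
  then obtain p where p: "\<And>i. i \<le> k \<Longrightarrow> p i \<in> {1..n}"
    "\<And>i. i < k \<Longrightarrow> p i < p (Suc i) \<and> {p i, p (Suc i)} \<in> E"
    unfolding contains_path_def path_copy_def by blast
  have "i \<le> a (p i)" if "i \<le> k" for i
    using that
  proof (induction i)
    case (Suc i)
    then show ?case using assms(2)[of "p i" "p (Suc i)"] p(1)[of i] p(1)[of "Suc i"] p(2)[of i] by simp
  qed simp
  from this[of k] show False using assms(1)[OF p(1)[of k]] by simp
qed

text \<open>The label of \<open>v\<close> is the length of a longest path ending at
  \<open>v\<close>; an edge from \<open>u\<close> to \<open>v\<close> extends every path ending at
  \<open>u\<close>.\<close>

lemma increasing_of_no_path:
  assumes "\<not> contains_path k n E"
  obtains a :: "nat \<Rightarrow> nat" where "\<And>v. v \<in> {1..n} \<Longrightarrow> a v < k"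
    and "\<And>u v. u \<in> {1..n} \<Longrightarrow> v \<in> {1..n} \<Longrightarrow> u < v \<Longrightarrow> {u, v} \<in> E \<Longrightarrow> a u < a v"
proof -
  define J where "J v = {j. \<exists>p. path_copy j n E p \<and> p j = v}" for v
  have bound: "j < k" if "j \<in> J v" for j v
  proof (rule ccontr)
    assume "\<not> j < k"
    moreover from that obtain p where "path_copy j n E p" unfolding J_def by blast
    ultimately have "path_copy k n E p" unfolding path_copy_def by simp
    then show False using assms unfolding contains_path_def by blast
  qed
  have fin: "finite (J v)" for v
    using bound by (meson finite_nat_set_iff_bounded)
  \<comment> \<open>The constant function is a path of length 0, so \<open>J v\<close> is nonempty
    and \<open>Max\<close> is meaningful.\<close>
  have zero: "0 \<in> J v" if "v \<in> {1..n}" for v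
    unfolding J_def path_copy_def using that by (auto intro!: exI[of _ "\<lambda>_. v"])
  have step: "Suc j \<in> J v" if "j \<in> J u" "v \<in> {1..n}" "u < v" "{u, v} \<in> E" for j u v
  proof -
    from that(1) obtain p where "path_copy j n E p" "p j = u" unfolding J_def by blast
    then have "path_copy (Suc j) n E (p(Suc j := v))"
      using that(2-4) unfolding path_copy_def by (auto simp: less_Suc_eq le_Suc_eq)
    then show ?thesis unfolding J_def by force
  qed
  show ?thesis
  proof (rule that[of "\<lambda>v. Max (J v)"])
    fix v assume "v \<in> {1..n}"
    then show "Max (J v) < k" using bound fin zero by (metis Max_in empty_iff)
  next
    fix u v assume uv: "u \<in> {1..n}" "v \<in> {1..n}" "u < v" "{u, v} \<in> E"
    have "Max (J u) \<in> J u" using fin zero[OF uv(1)] by (intro Max_in) auto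
    then have "Suc (Max (J u)) \<in> J v" using step uv by blast
    then show "Max (J u) < Max (J v)" using fin by (simp add: Suc_le_lessD)
  qed
qed

section \<open>The lower bound\<close>

text \<open>The colouring used here: \<open>D c\<close> is the \<open>c\<close>-th antidiagonal of the \<open>r \<times> s\<close> grid, with
  a point given by its first coordinate. Cauchy--Schwarz with \<open>\<Sum>c. card (D c) = r * s\<close> avoids
  the explicit sizes of the antidiagonals.\<close>

lemma ramsey_for_paths_card_ge:
  assumes "ordered_graph n E" "ramsey_for_paths r s n E" "1 \<le> r" "r \<le> s"
  shows "real r ^ 2 * real s \<le> 4 * real (card E)"
proof (rule ccontr)
  assume few: "\<not> ?thesis"
  define D where "D c = {a. a < r \<and> a \<le> c \<and> c - a < s}" for c
  have finD: "finite (D c)" for c unfolding D_def by simp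
  \<comment> \<open>The coordinate sum \<open>a + b\<close> runs from 0 to
    \<open>r + s - 2\<close>.\<close>
  let ?k = "r + s - 1"
  have E: "E \<subseteq> {e. e \<subseteq> {1..n} \<and> card e = 2}" using assms(1) unfolding ordered_graph_def .
  then have finE: "finite E" by (rule finite_subset) simp
  have card2: "\<And>e. e \<in> E \<Longrightarrow> card e = 2" using E by auto
  have "r * s = card ({..<r} \<times> {..<s})" by simp
  also have "\<dots> \<le> card (SIGMA c:{..<?k}. D c)"
  proof (rule card_inj_on_le[where f = "\<lambda>(a, b). (a + b, a)"])
    show "inj_on (\<lambda>(a, b). (a + b, a)) ({..<r} \<times> {..<s})" by (auto simp: inj_on_def)
    show "(\<lambda>(a, b). (a + b, a)) ` ({..<r} \<times> {..<s}) \<subseteq> (SIGMA c:{..<?k}. D c)"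
      by (auto simp: D_def)
    show "finite (SIGMA c:{..<?k}. D c)" using finD by auto
  qed
  also have "\<dots> = (\<Sum>c<?k. card (D c))" using finD by simp
  finally have "real (r * s) \<le> real (\<Sum>c<?k. card (D c))" by (simp only: of_nat_le_iff)
  then have "(real r * real s)\<^sup>2 \<le> (\<Sum>c<?k. real (card (D c)))\<^sup>2" by (intro power_mono) auto
  also have "\<dots> \<le> (\<Sum>c<?k. (real (card (D c)))\<^sup>2) * card {..<?k}"
    by (rule sum_squared_le_sum_of_squares)
  also have "\<dots> \<le> (\<Sum>c<?k. (real (card (D c)))\<^sup>2) * (2 * real s)"
    using assms(4) by (intro mult_left_mono sum_nonneg) auto
  finally have "real s * (real r ^ 2 * real s) \<le> real s * (2 * (\<Sum>c<?k. (real (card (D c)))\<^sup>2))"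
    by (simp add: power2_eq_square algebra_simps)
  then have sq: "real r ^ 2 * real s \<le> 2 * (\<Sum>c<?k. (real (card (D c)))\<^sup>2)"
    using assms(3,4) by simp
  have "(real d)\<^sup>2 \<le> 2 * real ((d + 1) choose 2)" for d
  proof -
    have "even ((d + 1) * d)" by simp
    then have "2 * ((d + 1) choose 2) = (d + 1) * d" by (simp add: choose_two)
    then have "2 * real ((d + 1) choose 2) = (real d + 1) * real d"
      by (metis of_nat_1 of_nat_add of_nat_mult of_nat_numeral)
    then show ?thesis by (simp add: power2_eq_square algebra_simps)
  qed
  then have "(\<Sum>c<?k. (real (card (D c)))\<^sup>2) \<le> (\<Sum>c<?k. 2 * real ((card (D c) + 1) choose 2))"
    by (intro sum_mono) blast
  then have "real r ^ 2 * real s \<le> 4 * real (\<Sum>c<?k. (card (D c) + 1) choose 2)"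
    using sq by (simp add: sum_distrib_left[symmetric])
  then have "card E < (\<Sum>c<?k. (card (D c) + 1) choose 2)" using few by linarith
  moreover have "{e \<in> E. e \<subseteq> {1..n}} = E" using E by auto
  ultimately have "card {e \<in> E. e \<subseteq> {1..n}} < (\<Sum>c<?k. (card (D c) + 1) choose 2)" by simp
  from level_colouring[OF finE card2 finD this] obtain h a where
    ha: "\<And>v. v \<in> {1..n} \<Longrightarrow> h v < ?k \<and> a v \<in> D (h v)"
      "\<And>u v. u \<in> {1..n} \<Longrightarrow> v \<in> {1..n} \<Longrightarrow> u < v \<Longrightarrow>
         h u \<le> h v \<and> ({u, v} \<in> E \<longrightarrow> h u = h v \<longrightarrow> a u \<noteq> a v)"
    by blast
  \<comment> \<open>An edge is red if the first coordinate rises. Otherwise the second coordinate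
    \<open>h - a\<close> rises: on one antidiagonal the values of \<open>a\<close> at its ends
    differ, and else \<open>h\<close> itself rises.\<close>
  define c where "c e = (if a (Min e) < a (Max e) then Red else Blue)" for e
  have c: "c {u, v} = (if a u < a v then Red else Blue)" if "u < v" for u v
    using that unfolding c_def by (simp add: min_def max_def)
  have "\<not> contains_path r n {e \<in> E. c e = Red}"
  proof (rule no_path_of_increasing[where a = a])
    show "a v < r" if "v \<in> {1..n}" for v using ha(1)[OF that] unfolding D_def by simp
  qed (auto simp: c split: if_splits)
  moreover have "\<not> contains_path s n {e \<in> E. c e = Blue}"
  proof (rule no_path_of_increasing[where a = "\<lambda>v. h v - a v"])
    show "h v - a v < s" if "v \<in> {1..n}" for v using ha(1)[OF that] unfolding D_def by simp
    fix u v assume uv: "u \<in> {1..n}" "v \<in> {1..n}" "u < v" "{u, v} \<in> {e \<in> E. c e = Blue}"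
    then have "a v \<le> a u" by (auto simp: c split: if_splits)
    then show "h u - a u < h v - a v"
      using ha(1)[OF uv(1)] ha(1)[OF uv(2)] ha(2)[OF uv(1-3)] uv(4) unfolding D_def
      by (cases "h u = h v") auto
  qed
  ultimately show False using assms(2) unfolding ramsey_for_paths_def by blast
qed

section \<open>Greedy hitting sets\<close>

text \<open>Always pick the element hitting the most sets: each step leaves at most a fraction
  \<open>1 - B / W\<close> of the sets unhit.\<close>

lemma greedy_hitting_set:
  fixes S :: "'i \<Rightarrow> 'e set" and w :: "'e \<Rightarrow> real"
  assumes "finite P" "finite I" "\<And>e. e \<in> P \<Longrightarrow> 0 \<le> w e" "\<And>i. i \<in> I \<Longrightarrow> S i \<subseteq> P"
    and "0 < B" "\<And>i. i \<in> I \<Longrightarrow> B \<le> sum w (S i)" "sum w P \<le> W"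
  shows "\<exists>E\<subseteq>P. (\<forall>i\<in>I. E \<inter> S i \<noteq> {}) \<and> real (card E) \<le> 1 + W / B * ln (real (card I))"
proof (cases "I = {}")
  case True
  \<comment> \<open>Here \<open>ln 0 = 0\<close>, so the bound reads
    \<open>0 \<le> 1\<close>.\<close>
  then show ?thesis by (intro exI[of _ "{}"]) simp
next
  case False
  then obtain i0 where i0: "i0 \<in> I" by blast
  have "B \<le> sum w (S i0)" using assms(6) i0 .
  also have "\<dots> \<le> sum w P" using assms(1,3) assms(4)[OF i0] by (intro sum_mono2) auto
  finally have BP: "B \<le> sum w P" .
  then have BW: "B \<le> W" using assms(7) by linarith
  have "P \<noteq> {}" using BP assms(5) by auto
  let ?q = "1 - B / W"
  have q: "0 \<le> ?q" using BW assms(5) by simp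
  have "\<exists>E\<subseteq>P. card E \<le> t \<and> real (card {i \<in> I. E \<inter> S i = {}}) \<le> real (card I) * ?q ^ t" for t
  proof (induction t)
    case 0
    then show ?case by (intro exI[of _ "{}"]) simp
  next
    case (Suc t)
    then obtain E where E: "E \<subseteq> P" "card E \<le> t"
      "real (card {i \<in> I. E \<inter> S i = {}}) \<le> real (card I) * ?q ^ t" by blast
    define I' where "I' = {i \<in> I. E \<inter> S i = {}}"
    define g where "g e = card {i \<in> I'. e \<in> S i}" for e
    have finI': "finite I'" unfolding I'_def using assms(2) by simp
    obtain e where e: "e \<in> P" "\<And>x. x \<in> P \<Longrightarrow> g x \<le> g e"
    proof -
      have "Max (g ` P) \<in> g ` P" using \<open>finite P\<close> \<open>P \<noteq> {}\<close> by (intro Max_in) auto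
      then obtain e where "e \<in> P" "Max (g ` P) = g e" by auto
      then show ?thesis using that[of e] \<open>finite P\<close> by (metis Max_ge finite_imageI imageI)
    qed
    \<comment> \<open>Averaging over weighted incidences: the best \<open>e\<close> hits at least
      the fraction \<open>B / W\<close> of the unhit sets.\<close>
    have "real (card I') * B = (\<Sum>i\<in>I'. B)" by simp
    also have "\<dots> \<le> (\<Sum>i\<in>I'. sum w {e \<in> P. e \<in> S i})"
    proof (rule sum_mono)
      fix i assume "i \<in> I'"
      then have "i \<in> I" unfolding I'_def by simp
      then have "{e \<in> P. e \<in> S i} = S i" using assms(4) by blast
      then show "B \<le> sum w {e \<in> P. e \<in> S i}" using assms(6)[OF \<open>i \<in> I\<close>] by simp
    qed
    also have "\<dots> = (\<Sum>e\<in>P. \<Sum>i | i \<in> I' \<and> e \<in> S i. w e)"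
      using finI' assms(1) by (rule sum.swap_restrict)
    also have "\<dots> = (\<Sum>e\<in>P. real (g e) * w e)" unfolding g_def by simp
    also have "\<dots> \<le> (\<Sum>x\<in>P. real (g e) * w x)"
      using e(2) assms(3) by (intro sum_mono mult_right_mono) auto
    also have "\<dots> \<le> real (g e) * W"
      using assms(7) by (simp add: sum_distrib_left[symmetric] mult_left_mono)
    finally have "real (card I') * (B / W) \<le> real (g e)"
      using BW assms(5) by (simp add: field_simps)
    moreover have "card {i \<in> I. insert e E \<inter> S i = {}} = card I' - g e"
    proof -
      have "{i \<in> I. insert e E \<inter> S i = {}} = I' - {i \<in> I'. e \<in> S i}" unfolding I'_def by auto
      then show ?thesis unfolding g_def using finI' by (simp add: card_Diff_subset)
    qed
    moreover have "g e \<le> card I'" unfolding g_def using finI' by (intro card_mono) auto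
    ultimately have "real (card {i \<in> I. insert e E \<inter> S i = {}}) \<le> real (card I') * ?q"
      by (simp add: algebra_simps)
    also have "\<dots> \<le> real (card I) * ?q ^ t * ?q"
      using E(3) q unfolding I'_def by (intro mult_right_mono) auto
    finally have "real (card {i \<in> I. insert e E \<inter> S i = {}}) \<le> real (card I) * ?q ^ Suc t"
      by (simp add: mult_ac)
    moreover have "card (insert e E) \<le> Suc t" using E(2) card_insert_le_m1 by (metis Suc_le_mono card_insert_if finite_subset[OF E(1) assms(1)] le_SucI)
    ultimately show ?case using E(1) e(1) by (intro exI[of _ "insert e E"]) auto
  qed
  note approx = this
  \<comment> \<open>\<open>t\<close> strictly exceeds \<open>W / B * ln (card I)\<close>; as
    \<open>1 - x \<le> exp (- x)\<close>, fewer than one set is then left unhit.\<close>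
  define t where "t = nat \<lfloor>W / B * ln (real (card I))\<rfloor> + 1"
  have cardI: "card I \<ge> 1" using False assms(2) by (simp add: Suc_le_eq card_gt_0_iff)
  have nonneg: "0 \<le> W / B * ln (real (card I))" using cardI BW assms(5) by simp
  then have t: "W / B * ln (real (card I)) < real t" "real t \<le> 1 + W / B * ln (real (card I))"
    unfolding t_def by linarith+
  from approx[of t] obtain E where E: "E \<subseteq> P" "card E \<le> t"
    "real (card {i \<in> I. E \<inter> S i = {}}) \<le> real (card I) * ?q ^ t" by blast
  have "?q ^ t \<le> exp (- (B / W)) ^ t" using q exp_ge_add_one_self[of "- (B / W)"]
    by (intro power_mono) auto
  also have "\<dots> = exp (- (real t * (B / W)))" by (simp add: exp_of_nat_mult[symmetric])
  also have "\<dots> < exp (- ln (real (card I)))"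
    using t(1) BW assms(5) by (simp add: field_simps)
  also have "\<dots> = 1 / real (card I)" using cardI by (simp add: exp_minus field_simps)
  finally have "real (card I) * ?q ^ t < 1" using cardI by (simp add: field_simps)
  then have "real (card {i \<in> I. E \<inter> S i = {}}) < 1" using E(3) by linarith
  then have "{i \<in> I. E \<inter> S i = {}} = {}" using assms(2) by simp
  then show ?thesis using E(1,2) t(2) by (intro exI[of _ E]) auto
qed

section \<open>Weight of the inversions of a labelling\<close>

text \<open>A discrete rising sun argument, scanning from the left. At the start of a sparse
  interval the scan jumps past that interval, which holds few points of \<open>U\<close>; otherwise
  it moves one step. The intervals jumped over are disjoint, so their contributions add up to at
  most \<open>\<delta>\<close> times the total length.\<close>

lemma card_sparse_points_le:
  fixes U :: "nat set" and \<delta> :: real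
  assumes "0 \<le> \<delta>" "a \<le> N + 1"
  shows "real (card {x \<in> U \<inter> {a..N}. \<exists>y\<in>{x..N}. real (card (U \<inter> {x..y})) < \<delta> * (real y + 1 - real x)})
    \<le> \<delta> * (real N + 1 - real a)"
  using assms(2)
proof (induction "N + 1 - a" arbitrary: a rule: less_induct)
  case less
  let ?sparse = "\<lambda>x. \<exists>y\<in>{x..N}. real (card (U \<inter> {x..y})) < \<delta> * (real y + 1 - real x)"
  let ?S = "\<lambda>a. {x \<in> U \<inter> {a..N}. ?sparse x}"
  consider "a = N + 1" | "a \<le> N" "\<not> ?sparse a" | "a \<le> N" "?sparse a" using less.prems by linarith
  then show ?case
  proof cases
    case 1
    then have "?S a = {}" by auto
    then show ?thesis using 1 by (simp only: card.empty) simp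
  next
    case 2
    have "?S a \<subseteq> ?S (a + 1)"
    proof
      fix x assume x: "x \<in> ?S a"
      then have "x \<noteq> a" using 2(2) by blast
      then show "x \<in> ?S (a + 1)" using x by auto
    qed
    then have "card (?S a) \<le> card (?S (a + 1))" by (intro card_mono) auto
    also have "real \<dots> \<le> \<delta> * (real N + 1 - real (a + 1))" using less.hyps[of "a + 1"] 2(1) by simp
    also have "\<dots> \<le> \<delta> * (real N + 1 - real a)" using assms(1) by (intro mult_left_mono) auto
    finally show ?thesis by simp
  next
    case 3
    then obtain y where y: "a \<le> y" "y \<le> N" "real (card (U \<inter> {a..y})) < \<delta> * (real y + 1 - real a)"
      by auto
    have "?S a \<subseteq> (U \<inter> {a..y}) \<union> ?S (y + 1)" by auto
    then have "card (?S a) \<le> card ((U \<inter> {a..y}) \<union> ?S (y + 1))" by (intro card_mono) auto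
    also have "\<dots> \<le> card (U \<inter> {a..y}) + card (?S (y + 1))" by (rule card_Un_le)
    finally have "real (card (?S a)) \<le> real (card (U \<inter> {a..y})) + real (card (?S (y + 1)))" by linarith
    also have "\<dots> \<le> \<delta> * (real y + 1 - real a) + \<delta> * (real N + 1 - real (y + 1))"
      using y(3) less.hyps[of "y + 1"] y(1,2) by (intro add_mono) auto
    finally show ?thesis by (simp add: algebra_simps)
  qed
qed

text \<open>Ties count as inversions because \<open>b\<close> has to increase strictly along blue
  edges: an inversion is a pair that cannot be a blue edge.\<close>

definition inversions :: "nat set \<Rightarrow> (nat \<Rightarrow> nat) \<Rightarrow> (nat \<times> nat) set" where
  "inversions U b = (SIGMA u:U. {v \<in> U. u < v \<and> b v \<le> b u})"

definition pair_weight :: "nat \<times> nat \<Rightarrow> real" where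
  "pair_weight e = 1 / (real (snd e) - real (fst e))"

text \<open>If \<open>(i, j)\<close> is an inversion, then for every \<open>k\<close> of \<open>U\<close> between them \<open>(i, k)\<close> or \<open>(k, j)\<close> is one
  too, so the inversions at \<open>i\<close> or \<open>j\<close> have total weight at least the density of \<open>U\<close> on \<open>{i..j}\<close>.
  Discard the points that start a sparse interval; the remaining ones that carry weight
  less than \<open>\<delta> / 2\<close> span no inversion, so \<open>b\<close> is injective on them.\<close>

lemma sum_pair_weight_inversions_ge:
  fixes \<delta> :: real
  assumes "U \<subseteq> {1..N}" "\<And>u. u \<in> U \<Longrightarrow> b u < s" "0 \<le> \<delta>"
  shows "(real (card U) - \<delta> * real N - real s) * (\<delta> / 4) \<le> sum pair_weight (inversions U b)"
proof -
  \<comment> \<open>\<open>out x\<close> and \<open>inn x\<close> collect the inversions with left,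
    respectively right, end \<open>x\<close>, so summing both over \<open>U\<close> counts each
    inversion twice.\<close>
  define out where "out u = (\<Sum>v | v \<in> U \<and> u < v \<and> b v \<le> b u. pair_weight (u, v))" for u
  define inn where "inn v = (\<Sum>u | u \<in> U \<and> u < v \<and> b v \<le> b u. pair_weight (u, v))" for v
  have finU: "finite U" using assms(1) finite_subset by blast
  have out: "(\<Sum>u\<in>U. out u) = sum pair_weight (inversions U b)"
    unfolding out_def inversions_def using finU by (subst sum.Sigma) auto
  moreover have "(\<Sum>u\<in>U. out u) = (\<Sum>v\<in>U. inn v)"
    unfolding out_def inn_def using finU by (intro sum.swap_restrict)
  ultimately have total: "2 * sum pair_weight (inversions U b) = (\<Sum>x\<in>U. out x + inn x)"
    by (simp add: sum.distrib)
  have nonneg: "0 \<le> out x" "0 \<le> inn x" for x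
    unfolding out_def inn_def pair_weight_def by (auto intro!: sum_nonneg)
  define T where
    "T = {x \<in> U \<inter> {1..N}. \<exists>y\<in>{x..N}. real (card (U \<inter> {x..y})) < \<delta> * (real y + 1 - real x)}"
  have "real (card T) \<le> \<delta> * real N"
    unfolding T_def using card_sparse_points_le[of \<delta> 1 N U] assms(3) by simp
  have key: "\<delta> \<le> out i + inn j" if ij: "i \<in> U - T" "j \<in> U" "i < j" "b j \<le> b i" for i j
  proof -
    \<comment> \<open>The end \<open>j\<close> is counted in \<open>?A\<close> and \<open>i\<close>
      in \<open>?B\<close>, so all of \<open>U\<close> in \<open>{i..j}\<close> is covered. All
      partners lie within distance \<open>j - i\<close>, so each pair weighs at least
      \<open>1 / (j - i)\<close>.\<close>
    let ?A = "{k \<in> U. i < k \<and> k \<le> j \<and> b k \<le> b i}"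
    let ?B = "{k \<in> U. i \<le> k \<and> k < j \<and> b j \<le> b k}"
    have "U \<inter> {i..j} \<subseteq> ?A \<union> ?B"
    proof
      fix k assume "k \<in> U \<inter> {i..j}"
      then show "k \<in> ?A \<union> ?B" using ij by (cases "k = i"; cases "k = j"; cases "b k \<le> b i") auto
    qed
    then have "card (U \<inter> {i..j}) \<le> card (?A \<union> ?B)" using finU by (intro card_mono) auto
    also have "\<dots> \<le> card ?A + card ?B" by (rule card_Un_le)
    finally have le: "real (card (U \<inter> {i..j})) \<le> real (card ?A) + real (card ?B)" by linarith
    have "i \<in> {1..N}" "j \<in> {1..N}" using ij(1,2) assms(1) by auto
    then have "\<not> real (card (U \<inter> {i..j})) < \<delta> * (real j + 1 - real i)"
      using ij(1,3) unfolding T_def by auto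
    then have "\<delta> * (real j + 1 - real i) \<le> real (card ?A) + real (card ?B)" using le by linarith
    moreover have "\<delta> * (real j - real i) \<le> \<delta> * (real j + 1 - real i)"
      using assms(3) by (intro mult_left_mono) auto
    ultimately have "\<delta> * (real j - real i) \<le> real (card ?A) + real (card ?B)" by linarith
    then have "\<delta> \<le> (real (card ?A) + real (card ?B)) / (real j - real i)"
      using ij(3) by (simp add: pos_le_divide_eq)
    then have "\<delta> \<le> real (card ?A) * (1 / (real j - real i)) + real (card ?B) * (1 / (real j - real i))"
      by (simp add: add_divide_distrib)
    also have "real (card ?A) * (1 / (real j - real i)) = (\<Sum>k\<in>?A. 1 / (real j - real i))" by simp
    also have "\<dots> \<le> (\<Sum>k\<in>?A. pair_weight (i, k))"
      unfolding pair_weight_def by (intro sum_mono) (auto intro!: divide_left_mono)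
    also have "\<dots> \<le> out i"
      unfolding out_def using finU by (intro sum_mono2) (auto simp: pair_weight_def)
    also have "real (card ?B) * (1 / (real j - real i)) = (\<Sum>k\<in>?B. 1 / (real j - real i))" by simp
    also have "\<dots> \<le> (\<Sum>k\<in>?B. pair_weight (k, j))"
      unfolding pair_weight_def by (intro sum_mono) (auto intro!: divide_left_mono)
    also have "\<dots> \<le> inn j"
      unfolding inn_def using finU by (intro sum_mono2) (auto simp: pair_weight_def)
    finally show ?thesis by simp
  qed
  define X where "X = {x \<in> U - T. out x + inn x < \<delta> / 2}"
  have "x = y" if "x \<in> X" "y \<in> X" "b x = b y" for x y
  proof (rule ccontr)
    have *: False if "x \<in> X" "y \<in> X" "b x = b y" "x < y" for x y
      using key[of x y] that nonneg(2)[of x] nonneg(1)[of y] unfolding X_def by auto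
    assume "x \<noteq> y"
    then show False using *[of x y] *[of y x] that by (metis linorder_neqE_nat)
  qed
  then have "card X \<le> card {..<s}"
    using assms(2) unfolding X_def by (intro card_inj_on_le[where f = b]) (auto simp: inj_on_def)
  then have cardX: "card X \<le> s" by simp
  have "X \<subseteq> U" "T \<subseteq> U" unfolding X_def T_def by auto
  then have "card (U - (T \<union> X)) = card U - card (T \<union> X)"
    using finU by (intro card_Diff_subset) (auto intro: finite_subset)
  \<comment> \<open>At most \<open>\<delta> * N\<close> points are lost to \<open>T\<close> and at
    most \<open>s\<close> to \<open>X\<close>. Each of the others carries at least
    \<open>\<delta> / 2\<close>; halving for the double count gives
    \<open>\<delta> / 4\<close>.\<close>
  then have "real (card U) - \<delta> * real N - real s \<le> real (card (U - (T \<union> X)))"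
    using cardX \<open>real (card T) \<le> \<delta> * real N\<close> card_Un_le[of T X] by linarith
  then have "(real (card U) - \<delta> * real N - real s) * (\<delta> / 2)
      \<le> real (card (U - (T \<union> X))) * (\<delta> / 2)"
    using assms(3) by (intro mult_right_mono) auto
  also have "\<dots> = (\<Sum>x\<in>U - (T \<union> X). \<delta> / 2)" by simp
  also have "\<dots> \<le> (\<Sum>x\<in>U - (T \<union> X). out x + inn x)"
    by (intro sum_mono) (auto simp: X_def)
  also have "\<dots> \<le> (\<Sum>x\<in>U. out x + inn x)"
    using finU nonneg by (intro sum_mono2) auto
  finally show ?thesis using total by simp
qed

text \<open>The pairs with a fixed left end have distinct distances, so together they weigh at most
  a harmonic number.\<close>

lemma sum_pair_weight_le:
  assumes "1 \<le> N"
  shows "sum pair_weight (SIGMA u:{1..N}. {u<..N}) \<le> real N * (1 + ln (real N))"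
proof -
  \<comment> \<open>\<open>harm N - ln N\<close> decreases and equals 1 at
    \<open>N = 1\<close>.\<close>
  have harm: "(harm N :: real) \<le> 1 + ln (real N)"
    using euler_mascheroni_sequence_decreasing[of 1 N] assms by (simp add: harm_def)
  have "(\<Sum>v\<in>{u<..N}. pair_weight (u, v)) \<le> harm N" for u
  proof -
    have "(\<Sum>v\<in>{u<..N}. pair_weight (u, v)) = (\<Sum>d\<in>{1..N - u}. inverse (real d))"
      by (rule sum.reindex_bij_witness[of _ "\<lambda>d. d + u" "\<lambda>v. v - u"])
        (auto simp: pair_weight_def of_nat_diff divide_simps)
    also have "\<dots> \<le> harm N" unfolding harm_def by (intro sum_mono2) auto
    finally show ?thesis .
  qed
  then have "(\<Sum>u\<in>{1..N}. \<Sum>v\<in>{u<..N}. pair_weight (u, v)) \<le> (\<Sum>u\<in>{1..N}. harm N)"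
    by (intro sum_mono)
  then have "sum pair_weight (SIGMA u:{1..N}. {u<..N}) \<le> real N * harm N"
    by (subst (asm) sum.Sigma) auto
  also have "\<dots> \<le> real N * (1 + ln (real N))" using harm by (simp add: mult_left_mono)
  finally show ?thesis .
qed

section \<open>The upper bound\<close>

text \<open>A colouring without the two paths yields labels \<open>a\<close> and \<open>b\<close>.
  By pigeonhole \<open>m\<close> vertices share a value of \<open>a\<close>; an edge among them
  cannot be red, and if it is an inversion of \<open>b\<close> it cannot be blue either.\<close>

lemma ramsey_for_paths_of_hitting_set:
  assumes E: "E \<subseteq> (SIGMA u:{1..n}. {u<..n})" and n: "r * m \<le> n" "1 \<le> r"
    and hit: "\<And>U b. U \<subseteq> {1..n} \<Longrightarrow> card U = m \<Longrightarrow> b \<in> U \<rightarrow>\<^sub>E {..<s} \<Longrightarrow> E \<inter> inversions U b \<noteq> {}"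
  shows "ramsey_for_paths r s n ((\<lambda>(u, v). {u, v}) ` E)"
  unfolding ramsey_for_paths_def
proof (rule allI, rule ccontr)
  fix c :: "nat set \<Rightarrow> colour"
  let ?E = "(\<lambda>(u, v). {u, v}) ` E"
  assume neg: "\<not> (contains_path r n {e \<in> ?E. c e = Red} \<or> contains_path s n {e \<in> ?E. c e = Blue})"
  then have "\<not> contains_path r n {e \<in> ?E. c e = Red}" by blast
  then obtain a where a: "\<And>v. v \<in> {1..n} \<Longrightarrow> a v < r"
    "\<And>u v. u \<in> {1..n} \<Longrightarrow> v \<in> {1..n} \<Longrightarrow> u < v \<Longrightarrow> {u, v} \<in> {e \<in> ?E. c e = Red} \<Longrightarrow> a u < a v"
    by (rule increasing_of_no_path) (rule that)
  from neg have "\<not> contains_path s n {e \<in> ?E. c e = Blue}" by blast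
  then obtain b where b: "\<And>v. v \<in> {1..n} \<Longrightarrow> b v < s"
    "\<And>u v. u \<in> {1..n} \<Longrightarrow> v \<in> {1..n} \<Longrightarrow> u < v \<Longrightarrow> {u, v} \<in> {e \<in> ?E. c e = Blue} \<Longrightarrow> b u < b v"
    by (rule increasing_of_no_path) (rule that)
  have "\<exists>i<r. m \<le> card {v \<in> {1..n}. a v = i}"
  proof (rule ccontr)
    assume "\<not> ?thesis"
    then have small: "card {v \<in> {1..n}. a v = i} < m" if "i < r" for i using that by (meson not_le)
    have "{1..n} = (\<Union>i<r. {v \<in> {1..n}. a v = i})" using a(1) by auto
    then have "n \<le> card (\<Union>i<r. {v \<in> {1..n}. a v = i})" by (metis card_atLeastAtMost diff_Suc_1 le_refl)
    also have "\<dots> \<le> (\<Sum>i<r. card {v \<in> {1..n}. a v = i})" by (rule card_UN_le) simp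
    also have "\<dots> < (\<Sum>i<r. m)"
    proof (rule sum_strict_mono)
      show "{..<r} \<noteq> {}" using n(2) by (simp add: lessThan_empty_iff)
    qed (use small in auto)
    finally show False using n(1) by simp
  qed
  then obtain i where "m \<le> card {v \<in> {1..n}. a v = i}" by blast
  then obtain U where U: "U \<subseteq> {v \<in> {1..n}. a v = i}" "card U = m"
    using obtain_subset_with_card_n by metis
  \<comment> \<open>Labellings are extensional so that only finitely many sets have to be hit;
    restricting keeps the values on \<open>U\<close>.\<close>
  have "restrict b U \<in> U \<rightarrow>\<^sub>E {..<s}" using U(1) b(1) by auto
  then have "E \<inter> inversions U (restrict b U) \<noteq> {}" using hit U by blast
  then obtain u v where uv: "(u, v) \<in> E" "(u, v) \<in> inversions U (restrict b U)" by auto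
  then have *: "u \<in> U" "v \<in> U" "u < v" "b v \<le> b u" unfolding inversions_def by auto
  then have "u \<in> {1..n}" "v \<in> {1..n}" "a u = a v" using U(1) by auto
  moreover have "{u, v} \<in> ?E" using uv(1) by force
  ultimately show False using a(2)[of u v] b(2)[of u v] * by (cases "c {u, v}") auto
qed

text \<open>A crude count suffices, since the greedy bound only sees its logarithm.\<close>

lemma card_labelled_subsets_le:
  assumes "m \<le> n"
  shows "card (SIGMA U:{U. U \<subseteq> {1..n::nat} \<and> card U = m}. U \<rightarrow>\<^sub>E {..<s::nat}) \<le> (n * s) ^ m"
    (is "card (Sigma ?A ?B) \<le> _")
proof -
  have fin: "finite U" if "U \<in> ?A" for U using that finite_subset by blast
  have card_fun: "card (?B U) = s ^ m" if "U \<in> ?A" for U using that fin[OF that] by (simp add: card_PiE)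
  have "finite ?A" by simp
  have "card (Sigma ?A ?B) = (\<Sum>U\<in>?A. card (?B U))"
  proof (rule card_SigmaI[OF \<open>finite ?A\<close>], rule ballI)
    show "finite (?B U)" if "U \<in> ?A" for U using fin[OF that] by (rule finite_PiE) simp
  qed
  also have "\<dots> = (\<Sum>U\<in>?A. s ^ m)" using card_fun by (intro sum.cong) auto
  also have "\<dots> = (n choose m) * s ^ m" using n_subsets[of "{1..n}" m] by simp
  also have "\<dots> \<le> n ^ m * s ^ m" using binomial_le_pow[OF assms] by simp
  finally show ?thesis by (simp add: power_mult_distrib)
qed

lemma exists_ramsey_for_paths:
  assumes "2 \<le> r" "r \<le> s"
  shows "\<exists>n E. ordered_graph n E \<and> ramsey_for_paths r s n E \<and>
    real (card E) \<le> 16000 * real r ^ 2 * real s * ln (real s) ^ 3"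
proof -
  \<comment> \<open>With \<open>\<delta> = 1 / (2 * r)\<close>, of the \<open>4 * s\<close> points
    at most \<open>\<delta> * N = 2 * s\<close> start sparse intervals and at most \<open>s\<close>
    are light. So at least \<open>s\<close> remain, which gives
    \<open>B = s * \<delta> / 4\<close>.\<close>
  define m where "m = 4 * s"
  define N where "N = r * m"
  define I where "I = (SIGMA U:{U. U \<subseteq> {1..N} \<and> card U = m}. U \<rightarrow>\<^sub>E {..<s})"
  define P where "P = (SIGMA u:{1..N}. {u<..N})"
  define S where "S = (\<lambda>(U, b). inversions U b)"
  define L where "L = ln (real s)"
  define W where "W = 24 * real r * real s * L"
  define B where "B = real s / (8 * real r)"
  have pos: "0 < real r" "0 < real s" using assms by auto
  have "2 / 3 \<le> ln (2 :: real)" by (rule ln2_ge_two_thirds)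
  also have "\<dots> \<le> L" unfolding L_def using assms by simp
  finally have L: "2 / 3 \<le> L" .
  have mN: "m \<le> N" unfolding N_def using assms by simp
  \<comment> \<open>\<open>N = 4 * r * s \<le> 4 * s^2 \<le> s^4\<close>, as
    \<open>s \<ge> 2\<close>.\<close>
  have N_le: "real N \<le> real s ^ 4"
  proof -
    have "N \<le> 4 * s * s" unfolding N_def m_def using assms(2) by simp
    also have "\<dots> \<le> (s * s) * (s * s)"
    proof -
      have "2 * 2 \<le> s * s" using assms by (intro mult_le_mono) auto
      then show ?thesis by simp
    qed
    finally have "real N \<le> real ((s * s) * (s * s))" by (simp only: of_nat_le_iff)
    then show ?thesis by (simp add: power4_eq_xxxx)
  qed
  have N1: "1 \<le> N" unfolding N_def m_def using assms by simp
  have lnN: "ln (real N) \<le> 4 * L"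
  proof -
    have "ln (real N) \<le> ln (real s ^ 4)" using N_le N1 pos by (subst ln_le_cancel_iff) auto
    then show ?thesis unfolding L_def using pos by (simp add: ln_realpow)
  qed
  have finI: "finite I" unfolding I_def
    by (intro finite_SigmaI finite_PiE) (auto intro: finite_subset)
  have "sum pair_weight P \<le> real N * (1 + ln (real N))" unfolding P_def by (rule sum_pair_weight_le[OF N1])
  \<comment> \<open>The summand 1 is absorbed by \<open>1 \<le> 2 * L\<close>.\<close>
  also have "\<dots> \<le> real N * (6 * L)" using lnN L by (intro mult_left_mono) auto
  also have "\<dots> = W" unfolding W_def N_def m_def by simp
  finally have WP: "sum pair_weight P \<le> W" .
  have "\<exists>E\<subseteq>P. (\<forall>i\<in>I. E \<inter> S i \<noteq> {}) \<and> real (card E) \<le> 1 + W / B * ln (real (card I))"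
  proof (rule greedy_hitting_set[where w = pair_weight])
    show "finite P" unfolding P_def by auto
    show "finite I" by (rule finI)
    show "0 \<le> pair_weight e" if "e \<in> P" for e using that unfolding P_def pair_weight_def by auto
    show "S i \<subseteq> P" if "i \<in> I" for i
      using that unfolding S_def I_def P_def inversions_def by auto
    show "0 < B" unfolding B_def using pos by simp
    show "B \<le> sum pair_weight (S i)" if i: "i \<in> I" for i
    proof -
      obtain U b where Ub: "i = (U, b)" "U \<subseteq> {1..N}" "card U = m" "b \<in> U \<rightarrow>\<^sub>E {..<s}"
        using i unfolding I_def by auto
      have "B = (real (card U) - 1 / (2 * real r) * real N - real s) * ((1 / (2 * real r)) / 4)"
        unfolding B_def N_def Ub(3) m_def using pos by (simp add: field_simps)
      also have "\<dots> \<le> sum pair_weight (inversions U b)"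
        using Ub(2,4) by (intro sum_pair_weight_inversions_ge) auto
      finally show ?thesis unfolding S_def Ub(1) by simp
    qed
    show "sum pair_weight P \<le> W" by (rule WP)
  qed
  then obtain E where E: "E \<subseteq> P" "\<And>i. i \<in> I \<Longrightarrow> E \<inter> S i \<noteq> {}"
    "real (card E) \<le> 1 + W / B * ln (real (card I))" by blast
  have lnI: "ln (real (card I)) \<le> 20 * real s * L"
  proof (cases "card I = 0")
    case True
    then show ?thesis using L pos by simp
  next
    case False
    have "card I \<le> (N * s) ^ m" unfolding I_def by (rule card_labelled_subsets_le[OF mN])
    then have "real (card I) \<le> real ((N * s) ^ m)" by (simp only: of_nat_le_iff)
    then have "ln (real (card I)) \<le> ln ((real N * real s) ^ m)" using False N1 pos
      by (subst ln_le_cancel_iff) auto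
    also have "\<dots> = real m * (ln (real N) + L)"
      unfolding L_def using N1 pos by (simp add: ln_realpow ln_mult)
    also have "\<dots> \<le> real m * (5 * L)" using lnN by (intro mult_left_mono) auto
    finally show ?thesis unfolding m_def by simp
  qed
  have WB: "W / B = 192 * real r ^ 2 * L"
    unfolding W_def B_def using pos by (simp add: field_simps power2_eq_square)
  have "real (card E) \<le> 1 + 192 * real r ^ 2 * L * (20 * real s * L)"
  proof -
    have "192 * real r ^ 2 * L * ln (real (card I)) \<le> 192 * real r ^ 2 * L * (20 * real s * L)"
      using lnI L by (intro mult_left_mono) auto
    then show ?thesis using E(3) unfolding WB by linarith
  qed
  \<comment> \<open>From \<open>L \<ge> 2 / 3\<close> come
    \<open>1 \<le> 3 * (r^2 * s * L^2)\<close>, absorbed in raising 3840 to 4000, and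
    \<open>1 \<le> 4 * L\<close>, which turns \<open>L^2\<close> into \<open>L^3\<close> and 4000
    into 16000.\<close>
  also have "\<dots> \<le> 16000 * real r ^ 2 * real s * L ^ 3"
  proof -
    have "1 * 1 \<le> real r ^ 2 * real s" using assms by (intro mult_mono) auto
    moreover have "(2 / 3) ^ 2 \<le> L ^ 2" using L by (intro power_mono) auto
    ultimately have "1 * (2 / 3) ^ 2 \<le> real r ^ 2 * real s * L ^ 2"
      by (intro mult_mono[of _ _ "(2 / 3) ^ 2"]) simp_all
    then have "1 \<le> 3 * (real r ^ 2 * real s * L ^ 2)" by (simp add: power2_eq_square)
    moreover have "192 * real r ^ 2 * L * (20 * real s * L) = 3840 * (real r ^ 2 * real s * L ^ 2)"
      by (simp add: power2_eq_square)
    ultimately have "1 + 192 * real r ^ 2 * L * (20 * real s * L) \<le> 4000 * (real r ^ 2 * real s * L ^ 2)"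
      by linarith
    also have "\<dots> = 4000 * (real r ^ 2 * real s * L ^ 2) * 1" by simp
    also have "\<dots> \<le> 4000 * (real r ^ 2 * real s * L ^ 2) * (4 * L)"
      using L by (intro mult_left_mono) simp_all
    finally show ?thesis by (simp add: power3_eq_cube power2_eq_square)
  qed
  finally have card_E: "real (card E) \<le> 16000 * real r ^ 2 * real s * L ^ 3" .
  let ?E = "(\<lambda>(u, v). {u, v}) ` E"
  have finE: "finite E" using E(1) by (rule finite_subset) (auto simp: P_def)
  have "ordered_graph N ?E"
    unfolding ordered_graph_def using E(1) unfolding P_def by fastforce
  moreover have "ramsey_for_paths r s N ?E"
  proof (rule ramsey_for_paths_of_hitting_set[where m = m])
    show "E \<subseteq> (SIGMA u:{1..N}. {u<..N})" using E(1) unfolding P_def .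
    show "r * m \<le> N" unfolding N_def by simp
    show "1 \<le> r" using assms by simp
    show "E \<inter> inversions U b \<noteq> {}" if "U \<subseteq> {1..N}" "card U = m" "b \<in> U \<rightarrow>\<^sub>E {..<s}" for U b
      using E(2)[of "(U, b)"] that unfolding I_def S_def by simp
  qed
  moreover have "real (card ?E) \<le> real (card E)" using card_image_le[OF finE] by simp
  ultimately show ?thesis using card_E unfolding L_def by (intro exI[of _ N] exI[of _ ?E]) linarith
qed

section \<open>Both bounds for the minimum\<close>

theorem theorem1p1:
  shows "\<exists>C::real. C > 0 \<and> (\<forall>r s :: nat. 2 \<le> r \<and> r \<le> s \<longrightarrow>
           1 / 8 * real r ^ 2 * real s \<le> real (ordered_size_ramsey r s) \<and>
           real (ordered_size_ramsey r s) \<le> C * real r ^ 2 * real s * ln (real s) ^ 3)"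
proof (intro exI[of _ 16000] conjI allI impI)
  fix r s :: nat
  assume rs: "2 \<le> r \<and> r \<le> s"
  let ?M = "{m. \<exists>n E. ordered_graph n E \<and> card E = m \<and> ramsey_for_paths r s n E}"
  obtain n E where nE: "ordered_graph n E" "ramsey_for_paths r s n E"
    "real (card E) \<le> 16000 * real r ^ 2 * real s * ln (real s) ^ 3"
    using exists_ramsey_for_paths rs by blast
  then have card_mem: "card E \<in> ?M" by blast
  \<comment> \<open>The graph just found makes the set nonempty, so \<open>Inf\<close> is a true
    minimum and the lower bound applies to a graph attaining it.\<close>
  then have "ordered_size_ramsey r s \<in> ?M"
    unfolding ordered_size_ramsey_def by (intro Inf_nat_def1) blast
  then obtain n' E' where nE': "ordered_graph n' E'" "card E' = ordered_size_ramsey r s"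
    "ramsey_for_paths r s n' E'" by blast
  have "real r ^ 2 * real s \<le> 4 * real (ordered_size_ramsey r s)"
    using ramsey_for_paths_card_ge[OF nE'(1,3)] rs nE'(2) by simp
  then show "1 / 8 * real r ^ 2 * real s \<le> real (ordered_size_ramsey r s)" by simp
  have "ordered_size_ramsey r s \<le> card E"
    unfolding ordered_size_ramsey_def using card_mem by (intro cInf_lower) auto
  then show "real (ordered_size_ramsey r s) \<le> 16000 * real r ^ 2 * real s * ln (real s) ^ 3"
    using nE(3) by linarith
qed simp

end
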